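(* Let $X,Y$ be two Banach spaces, let $m\ge1$ and let $T:\overbrace{X\times\cdots\times X}^{m}\to Y$ be a symmetric multilinear ($m$-linear) operator. Then, for every $x_0,x_1\in X$, $$T(x_0+x_1,\ldots,x_0+x_1)=T(x_0,\ldots,x_0)-\sum_{k=1}^m(-1)^k\binom{m}{k}T(\overbrace{x_0+x_1,\ldots,x_0+x_1}^{m-k},\overbrace{x_1,\ldots,x_1}^{k}).$$
   Context: The overbrace indicates the number of arguments equal to the displayed vector. *)

theory Defs
  imports Complex_Main "HOL-Combinatorics.Permutations"
begin

text \<open>
  The power \<open>X\<^sup>m\<close> is represented by the lists of length \<open>m\<close> over \<open>X\<close>; an operator
  \<open>X\<^sup>m \<rightarrow> Y\<close> is a function on lists of which only the values on lists of length \<open>m\<close>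
  are constrained. No continuity is required. The scalars are real; a complex
  Banach space and a complex multilinear operator are covered by restriction of scalars.
\<close>

definition multilinear_op :: "nat \<Rightarrow> ('a::real_vector list \<Rightarrow> 'b::real_vector) \<Rightarrow> bool" where
  "multilinear_op m T \<longleftrightarrow>
     (\<forall>xs. length xs = m \<longrightarrow> (\<forall>i<m. linear (\<lambda>x. T (xs[i := x]))))"

definition symmetric_op :: "nat \<Rightarrow> ('a list \<Rightarrow> 'b) \<Rightarrow> bool" where
  "symmetric_op m T \<longleftrightarrow>
     (\<forall>xs \<sigma>. length xs = m \<longrightarrow> \<sigma> permutes {..<m} \<longrightarrow> T (permute_list \<sigma> xs) = T xs)"

end

theory Submission
  imports Defs
begin

text \<open>
  This is the binomial theorem for symmetric multilinear operators, applied to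
  \<open>x\<^sub>0 = (x\<^sub>0 + x\<^sub>1) - x\<^sub>1\<close>. By symmetry, the value of \<open>T\<close> depends only on how often each vector
  occurs among its arguments, so the vectors multiply formally like commuting variables, and
  \<open>T (x\<^sub>0, \<dots>, x\<^sub>0)\<close> is the expansion of \<open>((x\<^sub>0 + x\<^sub>1) - x\<^sub>1)\<^sup>m\<close>
  (\<open>multilinear_op_binomial\<close>). Its term for \<open>k = 0\<close> is \<open>T (x\<^sub>0 + x\<^sub>1, \<dots>, x\<^sub>0 + x\<^sub>1)\<close>, and solving for
  that term gives the identity.
\<close>

lemma multilinear_op_linear_entry:
  assumes "multilinear_op m T" and "length ys + length zs + 1 = m"
  shows "linear (\<lambda>x. T (ys @ x # zs))"
proof -
  have "linear (\<lambda>x. T ((ys @ 0 # zs)[length ys := x]))"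
    using assms(1)[unfolded multilinear_op_def, rule_format, of "ys @ 0 # zs" "length ys"] assms(2)
    by (simp only: length_append list.size)
  then show ?thesis by simp
qed

lemma symmetric_op_mset_eq:
  assumes "symmetric_op m T" and "length ys = m" and "mset xs = mset ys"
  shows "T xs = T ys"
proof -
  obtain \<sigma> where "\<sigma> permutes {..<length ys}" "permute_list \<sigma> ys = xs"
    using mset_eq_permutation[OF assms(3)] by blast
  then show ?thesis
    using assms(1,2) unfolding symmetric_op_def by blast
qed

lemma sum_binomial_Suc_scaleR:
  fixes h :: "nat \<Rightarrow> 'b::real_vector" and c :: real
  shows "(\<Sum>k\<le>Suc n. (c ^ k * real (Suc n choose k)) *\<^sub>R h k) =
         (\<Sum>k\<le>n. (c ^ k * real (n choose k)) *\<^sub>R h k) +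
         c *\<^sub>R (\<Sum>k\<le>n. (c ^ k * real (n choose k)) *\<^sub>R h (Suc k))"
proof -
  \<comment> \<open>The added top term vanishes; with it, both sums over \<open>{..Suc n}\<close> split off their terms at 0
    and Pascal's rule applies to the rest.\<close>
  have "(\<Sum>k\<le>n. (c ^ k * real (n choose k)) *\<^sub>R h k) =
        (\<Sum>k\<le>Suc n. (c ^ k * real (n choose k)) *\<^sub>R h k)"
    by simp
  then show ?thesis
    by (simp only: sum.atMost_Suc_shift)
      (simp add: algebra_simps sum.distrib scaleR_sum_right)
qed

text \<open>
  Linearity in one entry splits off a factor \<open>u + c v\<close>, and Pascal's rule collects the two
  resulting expansions. The unexpanded arguments \<open>xs\<close> have to be arbitrary because the induction
  moves the vector chosen from the split factor into them; symmetry then brings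
  it back into its block.
\<close>
lemma multilinear_op_binomial:
  fixes T :: "'a::real_vector list \<Rightarrow> 'b::real_vector" and c :: real
  assumes mult: "multilinear_op m T" and symm: "symmetric_op m T"
    and "n + length xs = m"
  shows "T (replicate n (u + c *\<^sub>R v) @ xs) =
         (\<Sum>k\<le>n. (c ^ k * real (n choose k)) *\<^sub>R T (replicate (n - k) u @ replicate k v @ xs))"
  using assms(3)
proof (induction n arbitrary: xs)
  case 0
  then show ?case by simp
next
  case (Suc n)
  let ?w = "u + c *\<^sub>R v"
  let ?h = "\<lambda>k. T (replicate (Suc n - k) u @ replicate k v @ xs)"
  have lin: "linear (\<lambda>x. T (replicate n ?w @ x # xs))"
    using Suc.prems by (intro multilinear_op_linear_entry[OF mult]) simp
  have u_back: "T (replicate (n - k) u @ replicate k v @ u # xs) = ?h k" if "k \<le> n" for k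
    using that Suc.prems by (intro symmetric_op_mset_eq[OF symm]) (auto simp: Suc_diff_le)
  have v_back: "T (replicate (n - k) u @ replicate k v @ v # xs) = ?h (Suc k)" if "k \<le> n" for k
    using that Suc.prems by (intro symmetric_op_mset_eq[OF symm]) auto
  have "T (replicate (Suc n) ?w @ xs) = T (replicate n ?w @ ?w # xs)"
    by (simp add: replicate_app_Cons_same)
  also have "\<dots> = T (replicate n ?w @ u # xs) + c *\<^sub>R T (replicate n ?w @ v # xs)"
    using linear_add[OF lin] linear_scale[OF lin] by simp
  also have "\<dots> = (\<Sum>k\<le>n. (c ^ k * real (n choose k)) *\<^sub>R ?h k) +
                  c *\<^sub>R (\<Sum>k\<le>n. (c ^ k * real (n choose k)) *\<^sub>R ?h (Suc k))"
    using Suc.IH[of "u # xs"] Suc.IH[of "v # xs"] Suc.prems u_back v_back by simp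
  also have "\<dots> = (\<Sum>k\<le>Suc n. (c ^ k * real (Suc n choose k)) *\<^sub>R ?h k)"
    by (rule sum_binomial_Suc_scaleR[symmetric])
  finally show ?case .
qed

theorem lemma4p5:
  fixes T :: "'a::banach list \<Rightarrow> 'b::banach" and m :: nat and x0 x1 :: 'a
  assumes "m \<ge> 1"
    and "multilinear_op m T"
    and "symmetric_op m T"
  shows "T (replicate m (x0 + x1)) =
           T (replicate m x0) -
           (\<Sum>k=1..m. ((-1) ^ k * real (m choose k)) *\<^sub>R
              T (replicate (m - k) (x0 + x1) @ replicate k x1))"
proof -
  let ?t = "\<lambda>k. ((-1) ^ k * real (m choose k)) *\<^sub>R
              T (replicate (m - k) (x0 + x1) @ replicate k x1)"
  have "T (replicate m x0) = (\<Sum>k\<le>m. ?t k)"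
    using multilinear_op_binomial[OF assms(2,3), of m "[]" "x0 + x1" "-1" x1] by simp
  also have "\<dots> = ?t 0 + (\<Sum>k=1..m. ?t k)"
    by (simp add: atMost_atLeast0 sum.atLeast_Suc_atMost)
  finally show ?thesis by simp
qed

end
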